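(* Let $k,\ell\ge0$. There is a bijection $g$ from the set of $(k,\ell)$-Baxter paths to the set of plane partitions in a $k\times\ell\times3$ box which carries rotation of a triple of paths by $180^\circ$ to complementation of plane partitions: if $P^{\mathrm{rot}}$ denotes the $180^\circ$ rotation of a $(k,\ell)$-Baxter path $P$ and $\pi^c$ the complement of a plane partition $\pi$ in the $k\times\ell\times 3$ box, then $g(P^{\mathrm{rot}})=g(P)^c$ for all $P$.
   Context: A $(k,\ell)$-Baxter path is a triple of pairwise non-intersecting (vertex-disjoint) lattice paths with unit East and North steps, the $i$-th path going from $A_i$ to $B_i$, where $A_1=(0,2)$, $A_2=(1,1)$, $A_3=(2,0)$ and $B_1=(k,\ell+2)$, $B_2=(k+1,\ell+1)$, $B_3=(k+2,\ell)$. Rotation by $180^\circ$ is about the point $(\frac{k+2}{2},\frac{\ell+2}{2})$; it maps the set of $(k,\ell)$-Baxter paths to itself. A plane partition in a $k\times\ell\times3$ box is an array $(\pi_{i,j})_{1\le i\le k,1\le j\le\ell}$ with entries in $\{0,1,2,3\}$, weakly decreasing along rows and columns. Its complement is $\pi^c_{i,j}=3-\pi_{k+1-i,\ell+1-j}$. *)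

theory Defs
  imports Complex_Main "HOL-Library.FuncSet"
begin

type_synonym point = "int \<times> int"

definition lattice_step :: "point \<Rightarrow> point \<Rightarrow> bool" where
  "lattice_step p q \<longleftrightarrow> q = (fst p + 1, snd p) \<or> q = (fst p, snd p + 1)"

text \<open>A path is represented by the list of all lattice points it visits, in order.\<close>

definition lattice_path :: "point \<Rightarrow> point \<Rightarrow> point list \<Rightarrow> bool" where
  "lattice_path a b p \<longleftrightarrow> p \<noteq> [] \<and> hd p = a \<and> last p = b \<and> successively lattice_step p"

definition baxter_paths :: "nat \<Rightarrow> nat \<Rightarrow> (point list \<times> point list \<times> point list) set" where
  "baxter_paths k l = {(p1, p2, p3).
     lattice_path (0, 2) (int k, int l + 2) p1 \<and>
     lattice_path (1, 1) (int k + 1, int l + 1) p2 \<and>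
     lattice_path (2, 0) (int k + 2, int l) p3 \<and>
     set p1 \<inter> set p2 = {} \<and> set p1 \<inter> set p3 = {} \<and> set p2 \<inter> set p3 = {}}"

text \<open>Rotation by 180 degrees about the point ((k+2)/2, (l+2)/2). It reverses the
  direction in which a path is traversed, and it exchanges the endpoints of the first
  path with those of the third one, so the rotated triple is listed in reverse order.\<close>

definition rotate_point :: "nat \<Rightarrow> nat \<Rightarrow> point \<Rightarrow> point" where
  "rotate_point k l p = (int k + 2 - fst p, int l + 2 - snd p)"

definition rotate_path :: "nat \<Rightarrow> nat \<Rightarrow> point list \<Rightarrow> point list" where
  "rotate_path k l p = rev (map (rotate_point k l) p)"

definition rotate_triple ::
  "nat \<Rightarrow> nat \<Rightarrow> point list \<times> point list \<times> point list \<Rightarrow> point list \<times> point list \<times> point list" where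
  "rotate_triple k l = (\<lambda>(p1, p2, p3). (rotate_path k l p3, rotate_path k l p2, rotate_path k l p1))"

text \<open>Arrays are extensional functions, that is, they take the value \<^const>\<open>undefined\<close>
  outside the index set, so that equality of functions is equality of arrays.\<close>

definition plane_partitions :: "nat \<Rightarrow> nat \<Rightarrow> nat \<Rightarrow> (nat \<times> nat \<Rightarrow> nat) set" where
  "plane_partitions k l m = {\<pi> \<in> {1..k} \<times> {1..l} \<rightarrow>\<^sub>E {0..m}.
     (\<forall>i\<in>{1..k}. \<forall>j\<in>{1..l}. \<forall>j'\<in>{1..l}. j \<le> j' \<longrightarrow> \<pi> (i, j') \<le> \<pi> (i, j)) \<and>
     (\<forall>i\<in>{1..k}. \<forall>i'\<in>{1..k}. \<forall>j\<in>{1..l}. i \<le> i' \<longrightarrow> \<pi> (i', j) \<le> \<pi> (i, j))}"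

text \<open>The subtractions of natural numbers do not truncate on \<open>plane_partitions k l m\<close>.\<close>

definition complement :: "nat \<Rightarrow> nat \<Rightarrow> nat \<Rightarrow> (nat \<times> nat \<Rightarrow> nat) \<Rightarrow> (nat \<times> nat \<Rightarrow> nat)" where
  "complement k l m \<pi> = (\<lambda>(i, j)\<in>{1..k} \<times> {1..l}. m - \<pi> (k + 1 - i, l + 1 - j))"

end

theory Submission
  imports Defs
begin

text \<open>
  All three starting points lie on the antidiagonal \<open>x + y = 2\<close>, and every step moves a path to
  the next antidiagonal. So a path is described by the function \<open>u\<close> counting its East steps among
  its first \<open>t\<close> steps, and two paths can only meet at equal times \<open>t\<close>. As the horizontal distance
  of two paths changes by at most one per step, they are disjoint exactly when the left one stays
  strictly left. After translating the three starting points to the origin this says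
  \<open>u\<^sub>1 \<le> u\<^sub>2 \<le> u\<^sub>3\<close> (\<open>mem_baxter_paths_iff\<close>): the paths become three weakly nested boundaries
  of Young diagrams in a \<open>k \<times> l\<close> rectangle.

  The entry of the plane partition at a cell is the number of these boundaries above the
  cell. Columns of the rectangle are numbered from the right, so that the cells below a boundary
  form a down-set. Cells on a common diagonal of the array are crossed at the same time \<open>t\<close>, and the
  position of the path at that time is where this diagonal crosses the boundary of the diagram. Hence
  \<open>u\<^sub>m t\<close> can be read off from the diagonal (\<open>stack_determines\<close>), and conversely counting the
  cells of each diagonal outside the level set \<open>{\<pi> \<ge> m}\<close> gives a path (\<open>east_count_outside\<close>).

  Rotation by \<open>180\<close> degrees exchanges the cells below a boundary with those above it, so the number
  of boundaries above the rotated cell is \<open>3\<close> minus the original number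
  (\<open>below_reverse\<close>).
\<close>

section \<open>Lattice paths as East step counts\<close>

definition east_count :: "nat \<Rightarrow> nat \<Rightarrow> (nat \<Rightarrow> nat) \<Rightarrow> bool" where
  "east_count k l u \<longleftrightarrow> u 0 = 0 \<and> u (k + l) = k \<and>
     (\<forall>t < k + l. u (Suc t) = u t \<or> u (Suc t) = Suc (u t))"

definition trace :: "int \<Rightarrow> int \<Rightarrow> nat \<Rightarrow> (nat \<Rightarrow> nat) \<Rightarrow> point list" where
  "trace a b n u = map (\<lambda>t. (a + int (u t), b + int t - int (u t))) [0..<Suc n]"

definition east :: "point list \<Rightarrow> nat \<Rightarrow> nat" where
  "east p t = nat (fst (p ! t) - fst (p ! 0))"

lemma length_trace [simp]: "length (trace a b n u) = Suc n"
  by (simp add: trace_def)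

lemma nth_trace:
  "t \<le> n \<Longrightarrow> trace a b n u ! t = (a + int (u t), b + int t - int (u t))"
  by (simp add: trace_def del: upt_Suc)

lemma set_trace: "set (trace a b n u) = (\<lambda>t. (a + int (u t), b + int t - int (u t))) ` {..n}"
  by (auto simp: trace_def simp del: upt_Suc)

lemma trace_cong: "(\<And>t. t \<le> n \<Longrightarrow> u t = v t) \<Longrightarrow> trace a b n u = trace a b n v"
  by (auto simp: trace_def simp del: upt_Suc)

lemma east_trace: "u 0 = 0 \<Longrightarrow> t \<le> n \<Longrightarrow> east (trace a b n u) t = u t"
  by (simp add: east_def nth_trace)

lemma east_count_mono:
  assumes "east_count k l u" "s \<le> t" "t \<le> k + l"
  shows "u s \<le> u t" and "u t \<le> u s + (t - s)"
proof -
  have "u s \<le> u t \<and> u t \<le> u s + (t - s)"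
    using assms(2,3)
  proof (induction t rule: dec_induct)
    case (step t)
    then have "u (Suc t) = u t \<or> u (Suc t) = Suc (u t)"
      using assms(1) by (simp add: east_count_def)
    with step show ?case by auto
  qed simp
  then show "u s \<le> u t" and "u t \<le> u s + (t - s)" by auto
qed

lemma east_count_bounds:
  assumes "east_count k l u" "t \<le> k + l"
  shows "u t \<le> t" "u t \<le> k" "t \<le> u t + l"
  using east_count_mono[OF assms(1), of 0 t] east_count_mono[OF assms(1), of t "k + l"] assms
  by (auto simp: east_count_def)

lemma lattice_path_trace:
  assumes "east_count k l u"
  shows "lattice_path (a, b) (a + int k, b + int l) (trace a b (k + l) u)"
proof -
  let ?p = "trace a b (k + l) u"
  have nonempty: "?p \<noteq> []"
    using length_trace[of a b "k + l" u] by fastforce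
  have "lattice_step (?p ! t) (?p ! Suc t)" if "t < k + l" for t
    using that assms by (auto simp: nth_trace lattice_step_def east_count_def)
  then have "successively lattice_step ?p"
    by (simp add: successively_conv_nth)
  moreover have "hd ?p = (a, b)" "last ?p = (a + int k, b + int l)"
    using assms nonempty by (auto simp: hd_conv_nth last_conv_nth nth_trace east_count_def)
  ultimately show ?thesis
    using nonempty by (simp add: lattice_path_def)
qed

lemma lattice_path_eq_trace:
  assumes p: "lattice_path (a, b) (a + int k, b + int l) p"
  shows "east_count k l (east p)" and "p = trace a b (k + l) (east p)"
proof -
  have ne: "p \<noteq> []" and hd: "p ! 0 = (a, b)"
    and last: "p ! (length p - 1) = (a + int k, b + int l)"
    and step: "\<And>t. Suc t < length p \<Longrightarrow> lattice_step (p ! t) (p ! Suc t)"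
    using p by (auto simp: lattice_path_def hd_conv_nth last_conv_nth successively_conv_nth)
  have pos: "p ! t = (a + int (east p t), b + int t - int (east p t))" if "t < length p" for t
    using that
  proof (induction t)
    case 0
    then show ?case by (simp add: hd east_def)
  next
    case (Suc t)
    then have IH: "fst (p ! t) = a + int (east p t)" "snd (p ! t) = b + int t - int (east p t)"
      by simp_all
    from step[OF Suc.prems] consider
      "p ! Suc t = (fst (p ! t) + 1, snd (p ! t))" | "p ! Suc t = (fst (p ! t), snd (p ! t) + 1)"
      by (auto simp: lattice_step_def)
    then show ?case
      by cases (simp_all add: IH east_def[of p "Suc t"] hd)
  qed
  have len: "length p = Suc (k + l)"
    using pos[of "length p - 1"] last ne by (cases "length p") auto
  show "p = trace a b (k + l) (east p)"
    by (rule nth_equalityI) (auto simp: len nth_trace pos)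
  have "east p (Suc t) = east p t \<or> east p (Suc t) = Suc (east p t)" if "t < k + l" for t
    using step[of t] pos[of t] pos[of "Suc t"] that by (auto simp: lattice_step_def len)
  moreover have "east p 0 = 0"
    by (simp add: east_def)
  moreover have "east p (k + l) = k"
    using last by (simp add: east_def len hd)
  ultimately show "east_count k l (east p)"
    by (simp add: east_count_def)
qed

section \<open>Disjointness and nesting\<close>

text \<open>The first path starts to the left. A point determines the time at which it is visited, so the
  paths are disjoint iff \<open>u t \<noteq> v t + d\<close> at all times; since the difference \<open>v t + d - u t\<close>
  drops by at most one per step, it cannot become negative without vanishing first.\<close>

lemma traces_disjoint_iff:
  assumes u: "east_count k l u" and v: "east_count k l v" and "0 < d"
  shows "set (trace a b (k + l) u) \<inter> set (trace (a + int d) (b - int d) (k + l) v) = {} \<longleftrightarrow>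
    (\<forall>t \<le> k + l. u t < v t + d)"
proof -
  have "set (trace a b (k + l) u) \<inter> set (trace (a + int d) (b - int d) (k + l) v) = {} \<longleftrightarrow>
      (\<forall>t \<le> k + l. u t \<noteq> v t + d)"
    unfolding set_trace by (fastforce simp: image_iff)
  also have "\<dots> \<longleftrightarrow> (\<forall>t \<le> k + l. u t < v t + d)"
  proof
    assume neq: "\<forall>t \<le> k + l. u t \<noteq> v t + d"
    show "\<forall>t \<le> k + l. u t < v t + d"
    proof (intro allI impI)
      fix t
      assume "t \<le> k + l"
      then show "u t < v t + d"
      proof (induction t)
        case 0
        then show ?case using u \<open>0 < d\<close> by (simp add: east_count_def)
      next
        case (Suc t)
        then have "u (Suc t) \<le> Suc (u t)" "v t \<le> v (Suc t)"
          using u v by (auto simp: east_count_def less_eq_Suc_le)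
        with Suc neq show ?case by (metis Suc_leD Suc_leI add_le_mono1 le_trans nat_less_le)
      qed
    qed
  qed auto
  finally show ?thesis .
qed

definition nested_counts ::
  "nat \<Rightarrow> nat \<Rightarrow> (nat \<Rightarrow> nat) \<Rightarrow> (nat \<Rightarrow> nat) \<Rightarrow> (nat \<Rightarrow> nat) \<Rightarrow> bool" where
  "nested_counts k l u1 u2 u3 \<longleftrightarrow> east_count k l u1 \<and> east_count k l u2 \<and> east_count k l u3 \<and>
     (\<forall>t \<le> k + l. u1 t \<le> u2 t \<and> u2 t \<le> u3 t)"

definition traces ::
  "nat \<Rightarrow> nat \<Rightarrow> (nat \<Rightarrow> nat) \<Rightarrow> (nat \<Rightarrow> nat) \<Rightarrow> (nat \<Rightarrow> nat) \<Rightarrow>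
    point list \<times> point list \<times> point list" where
  "traces k l u1 u2 u3 =
     (trace 0 2 (k + l) u1, trace 1 1 (k + l) u2, trace 2 0 (k + l) u3)"

lemma traces_mem_baxter_paths_iff:
  assumes "east_count k l u1" "east_count k l u2" "east_count k l u3"
  shows "traces k l u1 u2 u3 \<in> baxter_paths k l \<longleftrightarrow> nested_counts k l u1 u2 u3"
proof -
  have "lattice_path (0, 2) (int k, int l + 2) (trace 0 2 (k + l) u1)"
    "lattice_path (1, 1) (int k + 1, int l + 1) (trace 1 1 (k + l) u2)"
    "lattice_path (2, 0) (int k + 2, int l) (trace 2 0 (k + l) u3)"
    using lattice_path_trace[OF assms(1), of 0 2] lattice_path_trace[OF assms(2), of 1 1]
      lattice_path_trace[OF assms(3), of 2 0] by (simp_all add: add.commute)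
  moreover have
    "set (trace 0 2 (k + l) u1) \<inter> set (trace 1 1 (k + l) u2) = {} \<longleftrightarrow> (\<forall>t \<le> k + l. u1 t \<le> u2 t)"
    "set (trace 1 1 (k + l) u2) \<inter> set (trace 2 0 (k + l) u3) = {} \<longleftrightarrow> (\<forall>t \<le> k + l. u2 t \<le> u3 t)"
    "set (trace 0 2 (k + l) u1) \<inter> set (trace 2 0 (k + l) u3) = {} \<longleftrightarrow>
      (\<forall>t \<le> k + l. u1 t < u3 t + 2)"
    using traces_disjoint_iff[OF assms(1,2), of 1 0 2] traces_disjoint_iff[OF assms(2,3), of 1 1 1]
      traces_disjoint_iff[OF assms(1,3), of 2 0 2] by (simp_all add: less_Suc_eq_le)
  moreover have "\<forall>t \<le> k + l. u1 t < u3 t + 2"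
    if "\<forall>t \<le> k + l. u1 t \<le> u2 t" "\<forall>t \<le> k + l. u2 t \<le> u3 t"
    using that by fastforce
  ultimately show ?thesis
    using assms by (auto simp: traces_def baxter_paths_def nested_counts_def)
qed

lemma mem_baxter_paths_iff:
  "P \<in> baxter_paths k l \<longleftrightarrow>
    (\<exists>u1 u2 u3. nested_counts k l u1 u2 u3 \<and> P = traces k l u1 u2 u3)"
proof
  assume P: "P \<in> baxter_paths k l"
  obtain p1 p2 p3 where P_eq: "P = (p1, p2, p3)"
    by (cases P)
  have "lattice_path (0, 2) (0 + int k, 2 + int l) p1"
    "lattice_path (1, 1) (1 + int k, 1 + int l) p2"
    "lattice_path (2, 0) (2 + int k, 0 + int l) p3"
    using P by (simp_all add: P_eq baxter_paths_def add.commute)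
  note paths = this[THEN lattice_path_eq_trace(1)] this[THEN lattice_path_eq_trace(2)]
  have P_traces: "P = traces k l (east p1) (east p2) (east p3)"
    using paths(4-6) by (simp add: P_eq traces_def)
  then show "\<exists>u1 u2 u3. nested_counts k l u1 u2 u3 \<and> P = traces k l u1 u2 u3"
    using P traces_mem_baxter_paths_iff[OF paths(1-3)] by metis
next
  assume "\<exists>u1 u2 u3. nested_counts k l u1 u2 u3 \<and> P = traces k l u1 u2 u3"
  then show "P \<in> baxter_paths k l"
    using traces_mem_baxter_paths_iff by (metis nested_counts_def)
qed

section \<open>Stacking the Young diagrams below the paths\<close>

text \<open>The cell in row \<open>i\<close> and column \<open>j\<close> of the array is placed in the unit square with upper left
  corner \<open>(k - i, j)\<close>. This corner is on the antidiagonal reached after \<open>k + j - i\<close> steps, and the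
  square is below the path iff the path has not passed to the right of the corner by then.\<close>

definition below :: "nat \<Rightarrow> (nat \<Rightarrow> nat) \<Rightarrow> nat \<Rightarrow> nat \<Rightarrow> bool" where
  "below k u i j \<longleftrightarrow> u (k + j - i) \<le> k - i"

definition stack ::
  "nat \<Rightarrow> nat \<Rightarrow> (nat \<Rightarrow> nat) \<Rightarrow> (nat \<Rightarrow> nat) \<Rightarrow> (nat \<Rightarrow> nat) \<Rightarrow> nat \<times> nat \<Rightarrow> nat" where
  "stack k l u1 u2 u3 = (\<lambda>(i, j)\<in>{1..k} \<times> {1..l}.
     of_bool (below k u1 i j) + of_bool (below k u2 i j) + of_bool (below k u3 i j))"

definition stack_paths ::
  "nat \<Rightarrow> nat \<Rightarrow> point list \<times> point list \<times> point list \<Rightarrow> nat \<times> nat \<Rightarrow> nat" where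
  "stack_paths k l = (\<lambda>(p1, p2, p3). stack k l (east p1) (east p2) (east p3))"

lemma stack_cong:
  assumes "\<And>t. t \<le> k + l \<Longrightarrow> u1 t = v1 t \<and> u2 t = v2 t \<and> u3 t = v3 t"
  shows "stack k l u1 u2 u3 = stack k l v1 v2 v3"
  unfolding stack_def
proof (rule restrict_ext, clarify)
  fix i j
  assume "i \<in> {1..k}" "j \<in> {1..l}"
  then have "k + j - i \<le> k + l"
    by auto
  from assms[OF this]
  show "of_bool (below k u1 i j) + of_bool (below k u2 i j) + of_bool (below k u3 i j) =
      (of_bool (below k v1 i j) + of_bool (below k v2 i j) + of_bool (below k v3 i j) :: nat)"
    unfolding below_def by simp
qed

lemma stack_paths_traces:
  assumes "east_count k l u1" "east_count k l u2" "east_count k l u3"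
  shows "stack_paths k l (traces k l u1 u2 u3) = stack k l u1 u2 u3"
  unfolding stack_paths_def traces_def prod.case
  by (rule stack_cong) (use assms in \<open>simp add: east_count_def east_trace\<close>)

lemma below_antimono:
  assumes u: "east_count k l u" and "i \<le> i'" "j \<le> j'" "i' \<le> k" "j' \<le> l" "below k u i' j'"
  shows "below k u i j"
proof -
  have "u (k + j - i) \<le> u (k + j - i') + (i' - i)"
    using east_count_mono(2)[OF u, of "k + j - i'" "k + j - i"] assms by simp
  also have "u (k + j - i') \<le> u (k + j' - i')"
    using east_count_mono(1)[OF u, of "k + j - i'" "k + j' - i'"] assms by simp
  also have "\<dots> \<le> k - i'"
    using assms by (simp add: below_def)
  finally show ?thesis
    using assms by (simp add: below_def)
qed

lemma stack_mem_plane_partitions: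
  assumes "east_count k l u1" "east_count k l u2" "east_count k l u3"
  shows "stack k l u1 u2 u3 \<in> plane_partitions k l 3"
proof -
  have antimono: "stack k l u1 u2 u3 (i', j') \<le> stack k l u1 u2 u3 (i, j)"
    if "i \<in> {1..k}" "i' \<in> {1..k}" "j \<in> {1..l}" "j' \<in> {1..l}" "i \<le> i'" "j \<le> j'" for i i' j j'
    using that below_antimono[OF assms(1), of i i' j j'] below_antimono[OF assms(2), of i i' j j']
      below_antimono[OF assms(3), of i i' j j']
    by (auto simp: stack_def intro!: add_mono)
  have "stack k l u1 u2 u3 \<in> {1..k} \<times> {1..l} \<rightarrow>\<^sub>E {0..3}"
    unfolding stack_def by (rule restrict_PiE_iff[THEN iffD2]) auto
  then show ?thesis
    using antimono by (auto simp: plane_partitions_def)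
qed

text \<open>If \<open>u t < v t\<close>, then the square whose upper left corner is on antidiagonal \<open>t\<close>, one unit to the
  left of the position of \<open>v\<close>, is below \<open>u\<close> but not below \<open>v\<close>; the path bounds keep this square
  inside the rectangle.\<close>

lemma below_determines_le:
  assumes u: "east_count k l u" and v: "east_count k l v"
    and below: "\<And>i j. i \<in> {1..k} \<Longrightarrow> j \<in> {1..l} \<Longrightarrow> below k u i j \<Longrightarrow> below k v i j"
    and t: "t \<le> k + l"
  shows "v t \<le> u t"
proof (rule ccontr)
  assume "\<not> v t \<le> u t"
  then have less: "u t < v t" by simp
  note b = east_count_bounds[OF u t] east_count_bounds[OF v t]
  define i j where "i = k + 1 - v t" and "j = t + 1 - v t"
  have "i \<in> {1..k}" "j \<in> {1..l}" and corner: "k + j - i = t" "k - i = v t - 1"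
    using b less by (auto simp: i_def j_def)
  moreover have "below k u i j"
    unfolding below_def corner using less by simp
  ultimately have "below k v i j"
    by (intro below)
  then show False
    unfolding below_def corner using less by simp
qed

text \<open>Because the diagrams are nested, an entry of the stack tells which of them contain the cell:
  the first ones, as many as the entry says.\<close>

lemma stack_determines:
  assumes u: "nested_counts k l u1 u2 u3" and v: "nested_counts k l v1 v2 v3"
    and eq: "stack k l u1 u2 u3 = stack k l v1 v2 v3" and t: "t \<le> k + l"
  shows "u1 t = v1 t \<and> u2 t = v2 t \<and> u3 t = v3 t"
proof -
  have same: "(below k u1 i j \<longleftrightarrow> below k v1 i j) \<and> (below k u2 i j \<longleftrightarrow> below k v2 i j) \<and>
      (below k u3 i j \<longleftrightarrow> below k v3 i j)" if ij: "i \<in> {1..k}" "j \<in> {1..l}" for i j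
  proof -
    have "k + j - i \<le> k + l"
      using ij by auto
    then have "u1 (k + j - i) \<le> u2 (k + j - i)" "u2 (k + j - i) \<le> u3 (k + j - i)"
      "v1 (k + j - i) \<le> v2 (k + j - i)" "v2 (k + j - i) \<le> v3 (k + j - i)"
      using u v by (auto simp: nested_counts_def)
    then have "below k u3 i j \<Longrightarrow> below k u2 i j" "below k u2 i j \<Longrightarrow> below k u1 i j"
      "below k v3 i j \<Longrightarrow> below k v2 i j" "below k v2 i j \<Longrightarrow> below k v1 i j"
      by (auto simp: below_def)
    moreover have
      "of_bool (below k u1 i j) + of_bool (below k u2 i j) + of_bool (below k u3 i j) =
        (of_bool (below k v1 i j) + of_bool (below k v2 i j) + of_bool (below k v3 i j) :: nat)"
      using fun_cong[OF eq, of "(i, j)"] ij by (simp add: stack_def)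
    ultimately show ?thesis
      by (cases "below k u1 i j"; cases "below k u2 i j"; cases "below k u3 i j";
          cases "below k v1 i j"; cases "below k v2 i j"; cases "below k v3 i j") simp_all
  qed
  have counts: "east_count k l u1" "east_count k l u2" "east_count k l u3"
    "east_count k l v1" "east_count k l v2" "east_count k l v3"
    using u v by (simp_all add: nested_counts_def)
  note le = below_determines_le[OF _ _ _ t]
  have "u1 t = v1 t"
    by (intro antisym le counts) (simp_all add: same)
  moreover have "u2 t = v2 t"
    by (intro antisym le counts) (simp_all add: same)
  moreover have "u3 t = v3 t"
    by (intro antisym le counts) (simp_all add: same)
  ultimately show ?thesis by simp
qed

section \<open>Recovering the paths from a plane partition\<close>

text \<open>The squares with \<open>x\<close>-range \<open>[x - 1, x]\<close> whose upper left corner is on antidiagonal \<open>t\<close> have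
  column index \<open>j = t + 1 - x\<close> in the array. Those outside the level set \<open>{\<pi> \<ge> m}\<close> are counted; this
  includes the squares above the rectangle and excludes those underneath it, which makes the count
  start at \<open>0\<close>, end at \<open>k\<close> and grow by at most one per step without a case distinction on \<open>t\<close>.\<close>

definition outside :: "nat \<Rightarrow> nat \<Rightarrow> (nat \<times> nat \<Rightarrow> nat) \<Rightarrow> nat \<Rightarrow> nat \<Rightarrow> nat set" where
  "outside k l \<pi> m t = {x \<in> {1..k}. l + x \<le> t \<or> x \<le> t \<and> \<pi> (k + 1 - x, t + 1 - x) < m}"

lemma plane_partition_antimono:
  assumes "\<pi> \<in> plane_partitions k l m" "1 \<le> i" "i \<le> i'" "i' \<le> k" "1 \<le> j" "j \<le> j'" "j' \<le> l"
  shows "\<pi> (i', j') \<le> \<pi> (i, j)"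
proof -
  have "\<pi> (i', j') \<le> \<pi> (i', j)" "\<pi> (i', j) \<le> \<pi> (i, j)"
    using assms by (auto simp: plane_partitions_def)
  then show ?thesis by simp
qed

lemma finite_outside: "finite (outside k l \<pi> m t)"
  by (simp add: outside_def)

text \<open>Both coordinates of the array increase when \<open>x\<close> decreases along a diagonal, so the outside
  squares are the first ones.\<close>

lemma outside_eq:
  assumes \<pi>: "\<pi> \<in> plane_partitions k l n"
  shows "outside k l \<pi> m t = {1..card (outside k l \<pi> m t)}"
proof -
  let ?A = "outside k l \<pi> m t"
  have down: "x' \<in> ?A" if x: "x \<in> ?A" "1 \<le> x'" "x' \<le> x" for x x'
  proof (cases "l + x' \<le> t")
    case True
    then show ?thesis using x by (auto simp: outside_def)
  next
    case False
    then have "\<pi> (k + 1 - x', t + 1 - x') \<le> \<pi> (k + 1 - x, t + 1 - x)"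
      using x by (intro plane_partition_antimono[OF \<pi>]) (auto simp: outside_def)
    then show ?thesis
      using x False by (auto simp: outside_def)
  qed
  show ?thesis
  proof (cases "?A = {}")
    case False
    then have max: "Max ?A \<in> ?A" "\<And>x. x \<in> ?A \<Longrightarrow> x \<le> Max ?A"
      using finite_outside by auto
    have "?A = {1..Max ?A}"
    proof
      show "?A \<subseteq> {1..Max ?A}"
        using max(2) by (force simp: outside_def)
      show "{1..Max ?A} \<subseteq> ?A"
        using down[OF max(1)] by auto
    qed
    then have "card ?A = Max ?A"
      by (metis card_atLeastAtMost diff_Suc_1)
    with \<open>?A = {1..Max ?A}\<close> show ?thesis by simp
  qed simp
qed

lemma east_count_outside:
  assumes \<pi>: "\<pi> \<in> plane_partitions k l n"
  shows "east_count k l (\<lambda>t. card (outside k l \<pi> m t))"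
proof -
  have "outside k l \<pi> m 0 = {}"
    by (auto simp: outside_def)
  moreover have "outside k l \<pi> m (k + l) = {1..k}"
    by (auto simp: outside_def)
  moreover have "card (outside k l \<pi> m (Suc t)) = card (outside k l \<pi> m t) \<or>
      card (outside k l \<pi> m (Suc t)) = Suc (card (outside k l \<pi> m t))" for t
  proof -
    \<comment> \<open>Moving one cell to the right along a row keeps an outside square outside.\<close>
    have "outside k l \<pi> m t \<subseteq> outside k l \<pi> m (Suc t)"
    proof
      fix x
      assume x: "x \<in> outside k l \<pi> m t"
      show "x \<in> outside k l \<pi> m (Suc t)"
      proof (cases "l + x \<le> Suc t")
        case True
        then show ?thesis using x by (auto simp: outside_def)
      next
        case False
        then have "\<pi> (k + 1 - x, Suc t + 1 - x) \<le> \<pi> (k + 1 - x, t + 1 - x)"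
          using x by (intro plane_partition_antimono[OF \<pi>]) (auto simp: outside_def)
        then show ?thesis
          using x False by (auto simp: outside_def)
      qed
    qed
    then have lower: "card (outside k l \<pi> m t) \<le> card (outside k l \<pi> m (Suc t))"
      by (simp add: card_mono finite_outside)
    \<comment> \<open>So does moving down along a column of the array, which decreases both \<open>x\<close> and \<open>t\<close>.\<close>
    have "x \<in> outside k l \<pi> m t" if x: "Suc x \<in> outside k l \<pi> m (Suc t)" "1 \<le> x" for x
    proof (cases "l + x \<le> t")
      case True
      then show ?thesis using x by (auto simp: outside_def)
    next
      case False
      then have "\<pi> (k + 1 - x, t + 1 - x) \<le> \<pi> (k + 1 - Suc x, Suc t + 1 - Suc x)"
        using x by (intro plane_partition_antimono[OF \<pi>]) (auto simp: outside_def)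
      then show ?thesis
        using x False by (auto simp: outside_def)
    qed
    from this[of "card (outside k l \<pi> m (Suc t)) - 1"]
    have "card (outside k l \<pi> m (Suc t)) - 1 \<le> card (outside k l \<pi> m t)"
      using outside_eq[OF \<pi>, of m t] outside_eq[OF \<pi>, of m "Suc t"]
      by (cases "card (outside k l \<pi> m (Suc t)) \<le> 1") (auto simp: set_eq_iff)
    with lower show ?thesis by linarith
  qed
  ultimately show ?thesis
    by (simp add: east_count_def)
qed

lemma below_outside_iff:
  assumes \<pi>: "\<pi> \<in> plane_partitions k l n" and ij: "i \<in> {1..k}" "j \<in> {1..l}"
  shows "below k (\<lambda>t. card (outside k l \<pi> m t)) i j \<longleftrightarrow> m \<le> \<pi> (i, j)"
proof -
  let ?A = "outside k l \<pi> m (k + j - i)"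
  have "below k (\<lambda>t. card (outside k l \<pi> m t)) i j \<longleftrightarrow> k + 1 - i \<notin> {1..card ?A}"
    using ij by (auto simp: below_def)
  also have "\<dots> \<longleftrightarrow> k + 1 - i \<notin> ?A"
    using outside_eq[OF \<pi>, of m "k + j - i"] by simp
  also have "\<dots> \<longleftrightarrow> m \<le> \<pi> (i, j)"
  proof -
    have "k + 1 - (k + 1 - i) = i" "k + j - i + 1 - (k + 1 - i) = j"
      using ij by auto
    moreover have "\<not> l + (k + 1 - i) \<le> k + j - i" "k + 1 - i \<le> k + j - i" "k + 1 - i \<in> {1..k}"
      using ij by auto
    ultimately show ?thesis
      unfolding outside_def mem_Collect_eq by (metis not_le)
  qed
  finally show ?thesis .
qed

lemma plane_partition_eq_stack:
  assumes \<pi>: "\<pi> \<in> plane_partitions k l 3"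
  shows "\<exists>u1 u2 u3. nested_counts k l u1 u2 u3 \<and> stack k l u1 u2 u3 = \<pi>"
proof -
  define u where "u m = (\<lambda>t. card (outside k l \<pi> m t))" for m
  have "u m t \<le> u m' t" if "m \<le> m'" for m m' t
    unfolding u_def using that
    by (intro card_mono finite_outside) (auto simp: outside_def)
  then have "nested_counts k l (u 1) (u 2) (u 3)"
    using east_count_outside[OF \<pi>] by (simp add: nested_counts_def u_def)
  moreover have "stack k l (u 1) (u 2) (u 3) = \<pi>"
  proof (rule PiE_ext)
    show "stack k l (u 1) (u 2) (u 3) \<in> {1..k} \<times> {1..l} \<rightarrow>\<^sub>E {0..3}"
      unfolding stack_def by (rule restrict_PiE_iff[THEN iffD2]) auto
    show \<pi>_mem: "\<pi> \<in> {1..k} \<times> {1..l} \<rightarrow>\<^sub>E {0..3}"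
      using \<pi> by (simp add: plane_partitions_def)
    fix c
    assume c: "c \<in> {1..k} \<times> {1..l}"
    then obtain i j where ij: "c = (i, j)" "i \<in> {1..k}" "j \<in> {1..l}"
      by auto
    have "\<pi> c \<le> 3"
      using PiE_mem[OF \<pi>_mem c] by simp
    then have "\<pi> c = of_bool (1 \<le> \<pi> c) + of_bool (2 \<le> \<pi> c) + of_bool (3 \<le> \<pi> c)"
      by (simp add: of_bool_def)
    then show "stack k l (u 1) (u 2) (u 3) c = \<pi> c"
      using ij by (simp add: stack_def u_def below_outside_iff[OF \<pi>])
  qed
  ultimately show ?thesis by blast
qed

section \<open>Rotation and complementation\<close>

definition reverse :: "nat \<Rightarrow> nat \<Rightarrow> (nat \<Rightarrow> nat) \<Rightarrow> nat \<Rightarrow> nat" where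
  "reverse k l u t = k - u (k + l - t)"

lemma east_count_reverse:
  assumes u: "east_count k l u"
  shows "east_count k l (reverse k l u)"
proof -
  have "reverse k l u (Suc t) = reverse k l u t \<or> reverse k l u (Suc t) = Suc (reverse k l u t)"
    if "t < k + l" for t
  proof -
    let ?s = "k + l - Suc t"
    have "u (Suc ?s) = u ?s \<or> u (Suc ?s) = Suc (u ?s)" "Suc ?s = k + l - t"
      using u that by (auto simp: east_count_def)
    moreover have "u (k + l - t) \<le> k"
      using east_count_bounds(2)[OF u] by simp
    ultimately show ?thesis
      by (auto simp: reverse_def)
  qed
  then show ?thesis
    using u by (simp add: east_count_def reverse_def)
qed

lemma rotate_path_trace:
  assumes u: "east_count k l u"
  shows "rotate_path k l (trace a b (k + l) u) = trace (2 - a) (2 - b) (k + l) (reverse k l u)"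
proof (rule nth_equalityI)
  fix t
  assume "t < length (rotate_path k l (trace a b (k + l) u))"
  then have t: "t \<le> k + l"
    by (simp add: rotate_path_def)
  then have "u (k + l - t) \<le> k"
    using east_count_bounds(2)[OF u] by simp
  then show "rotate_path k l (trace a b (k + l) u) ! t =
      trace (2 - a) (2 - b) (k + l) (reverse k l u) ! t"
    using t by (simp add: rotate_path_def rev_nth nth_trace rotate_point_def reverse_def)
qed (simp add: rotate_path_def)

lemma rotate_triple_traces:
  assumes "east_count k l u1" "east_count k l u2" "east_count k l u3"
  shows "rotate_triple k l (traces k l u1 u2 u3) =
    traces k l (reverse k l u3) (reverse k l u2) (reverse k l u1)"
  using assms by (simp add: rotate_triple_def traces_def rotate_path_trace)

text \<open>A square is below the rotated path iff the rotated square is above the original path. The upper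
  left and the lower right corner of a square are neighbours on one antidiagonal, so the path either
  passes weakly left of the former or weakly right of the latter, that is, every square is either
  below the path or above it.\<close>

lemma below_reverse:
  assumes u: "east_count k l u" and "i \<in> {1..k}" "j \<in> {1..l}"
  shows "below k (reverse k l u) i j \<longleftrightarrow> \<not> below k u (k + 1 - i) (l + 1 - j)"
proof -
  have "k + l - (k + j - i) = l + i - j" "k + (l + 1 - j) - (k + 1 - i) = l + i - j"
    "k - (k + 1 - i) = i - 1"
    using assms by auto
  moreover have "u (l + i - j) \<le> k"
    using assms by (intro east_count_bounds(2)[OF u]) auto
  ultimately show ?thesis
    using assms by (auto simp: below_def reverse_def)
qed

lemma stack_reverse:
  assumes "east_count k l u1" "east_count k l u2" "east_count k l u3"
  shows "stack k l (reverse k l u3) (reverse k l u2) (reverse k l u1) =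
    complement k l 3 (stack k l u1 u2 u3)"
  unfolding complement_def
  by (subst stack_def, rule restrict_ext)
    (auto simp: stack_def below_reverse[OF assms(1)] below_reverse[OF assms(2)]
      below_reverse[OF assms(3)] of_bool_def)

section \<open>The bijection\<close>

theorem theorem2p1:
  fixes k l :: nat
  shows "\<exists>g. bij_betw g (baxter_paths k l) (plane_partitions k l 3) \<and>
    (\<forall>P\<in>baxter_paths k l. g (rotate_triple k l P) = complement k l 3 (g P))"
proof (intro exI[of _ "stack_paths k l"] conjI ballI)
  show "bij_betw (stack_paths k l) (baxter_paths k l) (plane_partitions k l 3)"
  proof (rule bij_betw_imageI)
    show "inj_on (stack_paths k l) (baxter_paths k l)"
    proof (rule inj_onI)
      fix P Q
      assume "P \<in> baxter_paths k l" "Q \<in> baxter_paths k l"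
        and eq: "stack_paths k l P = stack_paths k l Q"
      then obtain u1 u2 u3 v1 v2 v3
        where P: "nested_counts k l u1 u2 u3" "P = traces k l u1 u2 u3"
          and Q: "nested_counts k l v1 v2 v3" "Q = traces k l v1 v2 v3"
        unfolding mem_baxter_paths_iff by blast
      have "stack k l u1 u2 u3 = stack k l v1 v2 v3"
        using eq P Q by (simp add: nested_counts_def stack_paths_traces)
      then have "u1 t = v1 t \<and> u2 t = v2 t \<and> u3 t = v3 t" if "t \<le> k + l" for t
        using stack_determines[OF P(1) Q(1)] that by blast
      then show "P = Q"
        by (auto simp: P(2) Q(2) traces_def intro!: trace_cong)
    qed
    show "stack_paths k l ` baxter_paths k l = plane_partitions k l 3"
    proof
      show "stack_paths k l ` baxter_paths k l \<subseteq> plane_partitions k l 3"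
        by (auto simp: mem_baxter_paths_iff nested_counts_def stack_paths_traces
            stack_mem_plane_partitions)
      show "plane_partitions k l 3 \<subseteq> stack_paths k l ` baxter_paths k l"
      proof
        fix \<pi>
        assume "\<pi> \<in> plane_partitions k l 3"
        then obtain u1 u2 u3
          where u: "nested_counts k l u1 u2 u3" and \<pi>: "stack k l u1 u2 u3 = \<pi>"
          using plane_partition_eq_stack by blast
        from u have "\<pi> = stack_paths k l (traces k l u1 u2 u3)"
          by (simp add: \<pi> nested_counts_def stack_paths_traces)
        moreover from u have "traces k l u1 u2 u3 \<in> baxter_paths k l"
          unfolding mem_baxter_paths_iff by blast
        ultimately show "\<pi> \<in> stack_paths k l ` baxter_paths k l"
          by (rule image_eqI)
      qed
    qed
  qed
next
  fix P
  assume "P \<in> baxter_paths k l"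
  then obtain u1 u2 u3
    where "nested_counts k l u1 u2 u3" and P: "P = traces k l u1 u2 u3"
    unfolding mem_baxter_paths_iff by blast
  then have u: "east_count k l u1" "east_count k l u2" "east_count k l u3"
    by (simp_all add: nested_counts_def)
  then show "stack_paths k l (rotate_triple k l P) = complement k l 3 (stack_paths k l P)"
    by (simp add: P rotate_triple_traces stack_paths_traces east_count_reverse stack_reverse)
qed

end
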